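(* Let $n,q,m$ be positive integers, $\boldsymbol{W}\in\mathbb{R}^{n\times q}$ with $\mathrm{rank}(\boldsymbol{W})=n<q$, $\boldsymbol{T}\in\mathbb{R}^{n\times m}$ with $\mathrm{rank}(\boldsymbol{T})=m<n$, and $\boldsymbol{y}\in\mathbb{R}^n$. Fix $i\in\{1,\dots,n\}$, let $$\widetilde{\boldsymbol{W}}_i=\left(\boldsymbol{I}_q-\frac{\boldsymbol{W}^\dagger\boldsymbol{e}_i\boldsymbol{e}_i^\top(\boldsymbol{W}^{\dagger})^\top}{\boldsymbol{e}_i^\top\boldsymbol{G}_{\boldsymbol{W}}\boldsymbol{e}_i}\right)\boldsymbol{W}^\dagger,\qquad \boldsymbol{H}_i=\boldsymbol{T}(\widetilde{\boldsymbol{W}}_i\boldsymbol{T})^\dagger\widetilde{\boldsymbol{W}}_i,$$ and let $\widetilde{\varepsilon}_i=y_i-(\boldsymbol{w}_i^\top\widehat{\boldsymbol{\lambda}}^{(\sim i)}+\boldsymbol{t}_i^\top\widehat{\boldsymbol{\tau}}^{(\sim i)})$ be the leave-$i$-out prediction residual, where $\boldsymbol{w}_i^\top$ and $\boldsymbol{t}_i^\top$ are the $i$-th rows of $\boldsymbol{W}$ and $\boldsymbol{T}$ and $\widehat{\boldsymbol{\lambda}}^{(\sim i)},\widehat{\boldsymbol{\tau}}^{(\sim i)}$ are the leave-$i$-out partially regularized least squares coefficients (defined in the context). Then $$\widetilde{\varepsilon}_i=\boldsymbol{e}_i^\top\left[\mathrm{diag}(\boldsymbol{G}_{\boldsymb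ol{W}})\right]^{-1}\boldsymbol{G}_{\boldsymbol{W}}(\boldsymbol{I}_n-\boldsymbol{H}_i)\boldsymbol{y}.$$
   Context: Notation: $\boldsymbol{M}^\dagger$ is the Moore–Penrose pseudoinverse of $\boldsymbol{M}$; for $\boldsymbol{M}$ with $k$ rows, $\boldsymbol{P}_{\boldsymbol{M}}=\boldsymbol{M}\boldsymbol{M}^\dagger$ is the orthogonal projection onto the column space of $\boldsymbol{M}$, $\boldsymbol{P}_{\boldsymbol{M}}^\perp=\boldsymbol{I}_k-\boldsymbol{P}_{\boldsymbol{M}}$, and $\boldsymbol{G}_{\boldsymbol{M}}=(\boldsymbol{M}\boldsymbol{M}^\top)^\dagger$. For a square matrix $\boldsymbol{M}\in\mathbb{R}^{n\times n}$, $\mathrm{diag}(\boldsymbol{M})=\sum_{j=1}^nM_{jj}\boldsymbol{e}_j\boldsymbol{e}_j^\top$ is the diagonal matrix with the same diagonal. $\boldsymbol{e}_i$ is the $i$-th standard basis vector of $\mathbb{R}^n$. Partially regularized least squares: given a response $\boldsymbol{y}$ and covariates $[\boldsymbol{W},\boldsymbol{T}]$, among all minimizers $(\boldsymbol{\lambda},\boldsymbol{\tau})$ of $\|\boldsymbol{y}-\boldsymbol{W}\boldsymbol{\lambda}-\boldsymbol{T}\boldsymbol{\tau}\|_2^2$ one selects a minimizer of $\|\boldsymbol{\lambda}\|_2^2$ (the coefficients $\boldsymbol{\tau}$ of $\boldsymbol{T}$ are not penalized). The solution is given by the closed form $$\widehat{\boldsymbol{\lambda}}=(\boldsymbol{P}_{\boldsymbol{T}}^\perp\boldsymbol{W})^\dagger\boldsymbol{P}_{\boldsymbol{T}}^\perp\boldsymbol{y},\qquad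 \widehat{\boldsymbol{\tau}}=(\boldsymbol{W}^\dagger\boldsymbol{T})^\dagger\boldsymbol{W}^\dagger\boldsymbol{y}.$$ Leave-one-out: $\boldsymbol{W}_{\sim i}\in\mathbb{R}^{(n-1)\times q}$, $\boldsymbol{T}_{\sim i}\in\mathbb{R}^{(n-1)\times m}$, $\boldsymbol{y}_{\sim i}\in\mathbb{R}^{n-1}$ are obtained from $\boldsymbol{W},\boldsymbol{T},\boldsymbol{y}$ by deleting the $i$-th row/entry. The leave-$i$-out coefficients are the partially regularized solution for response $\boldsymbol{y}_{\sim i}$ and covariates $[\boldsymbol{W}_{\sim i},\boldsymbol{T}_{\sim i}]$, i.e. $$\widehat{\boldsymbol{\lambda}}^{(\sim i)}=(\boldsymbol{P}_{\boldsymbol{T}_{\sim i}}^\perp\boldsymbol{W}_{\sim i})^\dagger\boldsymbol{P}_{\boldsymbol{T}_{\sim i}}^\perp\boldsymbol{y}_{\sim i},\qquad \widehat{\boldsymbol{\tau}}^{(\sim i)}=\left((\boldsymbol{W}_{\sim i})^\dagger\boldsymbol{T}_{\sim i}\right)^\dagger(\boldsymbol{W}_{\sim i})^\dagger\boldsymbol{y}_{\sim i}.$$ *)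

theory Defs
  imports
    Complex_Main
    "Jordan_Normal_Form.DL_Rank"
    "Jordan_Normal_Form.Determinant"
    "Jordan_Normal_Form.Gauss_Jordan_Elimination"
begin

definition is_moore_penrose :: "real mat \<Rightarrow> real mat \<Rightarrow> bool" where
  "is_moore_penrose A X \<longleftrightarrow>
     X \<in> carrier_mat (dim_col A) (dim_row A) \<and>
     A * X * A = A \<and>
     X * A * X = X \<and>
     transpose_mat (A * X) = A * X \<and>
     transpose_mat (X * A) = X * A"

(* For every real matrix, including those without rows or columns, exactly one X
   satisfies the four Penrose equations. *)
definition pinv :: "real mat \<Rightarrow> real mat" where
  "pinv A = (THE X. is_moore_penrose A X)"

definition proj_perp :: "real mat \<Rightarrow> real mat" where
  "proj_perp A = 1\<^sub>m (dim_row A) - A * pinv A"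

definition gram_pinv :: "real mat \<Rightarrow> real mat" where
  "gram_pinv A = pinv (A * transpose_mat A)"

definition diag_part :: "real mat \<Rightarrow> real mat" where
  "diag_part A = mat_diag (dim_row A) (\<lambda>j. A $$ (j, j))"

(* mat_inverse returns None exactly for non-invertible matrices, where the value
   below is unspecified. *)
definition inv_mat :: "real mat \<Rightarrow> real mat" where
  "inv_mat A = the (mat_inverse A)"

definition delete_row :: "nat \<Rightarrow> 'a mat \<Rightarrow> 'a mat" where
  "delete_row i A =
     mat (dim_row A - 1) (dim_col A) (\<lambda>(k, j). A $$ (if k < i then k else Suc k, j))"

definition delete_entry :: "nat \<Rightarrow> 'a vec \<Rightarrow> 'a vec" where
  "delete_entry i v = vec (dim_vec v - 1) (\<lambda>k. v $ (if k < i then k else Suc k))"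

(* Partially regularized least squares in closed form: among the minimizers (l, t) of
   the squared norm of y - W l - T t, choose l of least norm; t is not penalized.
   The closed form for t presupposes that W has full row rank, as it does here even after
   deleting a row; when t is not unique, it selects the t of least norm. *)
definition prls_lambda :: "real mat \<Rightarrow> real mat \<Rightarrow> real vec \<Rightarrow> real vec" where
  "prls_lambda W T y = pinv (proj_perp T * W) *\<^sub>v (proj_perp T *\<^sub>v y)"

definition prls_tau :: "real mat \<Rightarrow> real mat \<Rightarrow> real vec \<Rightarrow> real vec" where
  "prls_tau W T y = pinv (pinv W * T) *\<^sub>v (pinv W *\<^sub>v y)"

definition loo_residual :: "real mat \<Rightarrow> real mat \<Rightarrow> real vec \<Rightarrow> nat \<Rightarrow> real" where
  "loo_residual W T y i =
     y $ i - (row W i \<bullet> prls_lambda (delete_row i W) (delete_row i T) (delete_entry i y)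
            + row T i \<bullet> prls_tau (delete_row i W) (delete_row i T) (delete_entry i y))"

(* The standard basis vector e_i is written as the one-column matrix E so that
   E * transpose_mat E is the outer product. *)
definition W_tilde :: "real mat \<Rightarrow> nat \<Rightarrow> real mat" where
  "W_tilde W i =
     (let e = unit_vec (dim_row W) i;
          E = mat_of_cols (dim_row W) [e]
      in (1\<^sub>m (dim_col W)
            - (1 / (e \<bullet> (gram_pinv W *\<^sub>v e)))
                \<cdot>\<^sub>m (pinv W * E * transpose_mat E * transpose_mat (pinv W)))
         * pinv W)"

definition H_mat :: "real mat \<Rightarrow> real mat \<Rightarrow> nat \<Rightarrow> real mat" where
  "H_mat W T i = T * pinv (W_tilde W i * T) * W_tilde W i"

end

theory Submission
  imports Defs
begin

text \<open>Put \<open>U = W\<^sup>+\<close>, \<open>G = U\<^sup>T U\<close> and let \<open>D\<close> be the matrix deleting the \<open>i\<close>-th entry. Since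
  \<open>W U = I\<close>, the matrix \<open>V = W_tilde W i\<close> satisfies \<open>V e\<^sub>i = 0\<close>, \<open>V = (D W)\<^sup>+ D\<close> and
  \<open>W V = I - e\<^sub>i e\<^sub>i\<^sup>T G / G\<^sub>i\<^sub>i\<close>. As \<open>D W\<close> has full row rank, its interpolating solutions satisfy
  \<open>\<lambda> = (D W)\<^sup>+ (D y - D T \<tau>)\<close>, so that \<open>T \<tau> = H\<^sub>i y\<close> and \<open>\<lambda> = V r\<close> with \<open>r = y - H\<^sub>i y\<close>. The
  residual is then \<open>r\<^sub>i - (W V r)\<^sub>i = (G r)\<^sub>i / G\<^sub>i\<^sub>i\<close>.\<close>

section \<open>Matrix algebra with dimension side conditions\<close>

text \<open>The laws below take equations between dimensions as premises instead of carrier sets: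
  the simplifier discharges them by computing dimensions and never has to guess one.\<close>

lemma mult_assoc_dim:
  fixes A :: "'a :: semiring_0 mat"
  shows "dim_col A = dim_row B \<Longrightarrow> dim_col B = dim_row C \<Longrightarrow> A * B * C = A * (B * C)"
  by (rule assoc_mult_mat) auto

lemma mult_assoc_vec_dim:
  fixes A :: "'a :: semiring_0 mat"
  shows "dim_col A = dim_row B \<Longrightarrow> dim_col B = dim_vec v \<Longrightarrow> A * B *\<^sub>v v = A *\<^sub>v (B *\<^sub>v v)"
  by (rule assoc_mult_mat_vec) auto

lemma transpose_mult_dim:
  fixes A :: "'a :: comm_semiring_0 mat"
  shows "dim_col A = dim_row B \<Longrightarrow> transpose_mat (A * B) = transpose_mat B * transpose_mat A"
  by (rule transpose_mult) auto

lemma minus_mult_dim: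
  fixes A :: "'a :: ring mat"
  shows "dim_row A = dim_row B \<Longrightarrow> dim_col A = dim_col B \<Longrightarrow> dim_col A = dim_row C \<Longrightarrow>
    (A - B) * C = A * C - B * C"
  by (rule minus_mult_distrib_mat) auto

lemma mult_minus_dim:
  fixes A :: "'a :: ring mat"
  shows "dim_row B = dim_row C \<Longrightarrow> dim_col B = dim_col C \<Longrightarrow> dim_col A = dim_row B \<Longrightarrow>
    A * (B - C) = A * B - A * C"
  by (rule mult_minus_distrib_mat) auto

lemma minus_zero_dim:
  fixes A :: "'a :: group_add mat"
  shows "dim_row A = n \<Longrightarrow> dim_col A = m \<Longrightarrow> A - 0\<^sub>m n m = A"
  by (rule eq_matI) auto

lemma smult_mult_dim:
  fixes A :: "'a :: comm_semiring_0 mat"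
  shows "dim_col A = dim_row B \<Longrightarrow> (k \<cdot>\<^sub>m A) * B = k \<cdot>\<^sub>m (A * B)"
  by (rule mult_smult_assoc_mat) auto

lemma mult_smult_dim:
  fixes A :: "'a :: comm_semiring_0 mat"
  shows "dim_col A = dim_row B \<Longrightarrow> A * (k \<cdot>\<^sub>m B) = k \<cdot>\<^sub>m (A * B)"
  by (rule mult_smult_distrib) auto

lemma transpose_minus_dim:
  fixes A :: "'a :: ab_group_add mat"
  shows "dim_row A = dim_row B \<Longrightarrow> dim_col A = dim_col B \<Longrightarrow>
    transpose_mat (A - B) = transpose_mat A - transpose_mat B"
  by (rule transpose_minus) auto

lemma transpose_smult: "transpose_mat (k \<cdot>\<^sub>m A) = k \<cdot>\<^sub>m transpose_mat A"
  by (rule eq_matI) auto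

lemma minus_mult_vec_dim:
  fixes A :: "'a :: ring mat"
  shows "dim_row A = dim_row B \<Longrightarrow> dim_col A = dim_col B \<Longrightarrow> dim_col A = dim_vec v \<Longrightarrow>
    (A - B) *\<^sub>v v = A *\<^sub>v v - B *\<^sub>v v"
  by (rule minus_mult_distrib_mat_vec) (auto intro: carrier_vecI)

lemma mult_minus_vec_dim:
  fixes A :: "'a :: ring mat"
  shows "dim_vec v = dim_vec w \<Longrightarrow> dim_col A = dim_vec v \<Longrightarrow>
    A *\<^sub>v (v - w) = A *\<^sub>v v - A *\<^sub>v w"
  by (rule mult_minus_distrib_mat_vec) (auto intro: carrier_vecI)

lemma smult_mult_vec_dim:
  fixes A :: "'a :: comm_semiring_0 mat"
  shows "dim_col A = dim_vec v \<Longrightarrow> (k \<cdot>\<^sub>m A) *\<^sub>v v = k \<cdot>\<^sub>v (A *\<^sub>v v)"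
  by (rule eq_vecI) (auto simp: scalar_prod_def sum_distrib_left mult.assoc)

lemmas dim_simps = mult_assoc_dim transpose_mult_dim minus_mult_dim mult_minus_dim
  minus_zero_dim smult_mult_dim mult_smult_dim
  transpose_minus_dim transpose_smult

lemma minus_mat_eq_0_iff:
  fixes A :: "'a :: group_add mat"
  assumes "A \<in> carrier_mat n m" "B \<in> carrier_mat n m"
  shows "A - B = 0\<^sub>m n m \<longleftrightarrow> A = B"
proof
  assume *: "A - B = 0\<^sub>m n m"
  have "A $$ (r, c) = B $$ (r, c)" if "r < n" "c < m" for r c
    using arg_cong[OF *, of "\<lambda>M. M $$ (r, c)"] that assms by auto
  with assms show "A = B" by (intro eq_matI) auto
qed (use assms in auto)

section \<open>Existence and uniqueness of the Moore--Penrose inverse\<close>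

text \<open>If \<open>C = P A\<close> is the reduced row echelon form, a matrix \<open>R\<close> sending the \<open>c\<close>-th unit vector to
  that of the \<open>c\<close>-th pivot column satisfies \<open>C R C = C\<close>, so \<open>R P\<close> is an inner inverse of \<open>A\<close>.\<close>

lemma inner_inverse_exists:
  fixes A :: "'a :: field mat"
  assumes A: "A \<in> carrier_mat nr nc"
  shows "\<exists>S \<in> carrier_mat nc nr. A * S * A = A"
proof -
  define C where "C = gauss_jordan_single A"
  note gj = gauss_jordan_single[OF A C_def[symmetric]]
  have C: "C \<in> carrier_mat nr nc" by (rule gj(2))
  obtain P Q where CPA: "C = P * A" and P: "P \<in> carrier_mat nr nr" and Q: "Q \<in> carrier_mat nr nr"
    and QP: "Q * P = 1\<^sub>m nr" using gj(4) by blast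
  obtain f where f: "pivot_fun C f nc" using gj(3) C unfolding row_echelon_form_def by auto
  have dC: "dim_row C = nr" using C by simp
  note p = pivot_funD[OF dC f]
  define R where "R = mat nc nr (\<lambda>(r, c). if f c = r then 1 else (0 :: 'a))"
  have R: "R \<in> carrier_mat nc nr" unfolding R_def by simp
  \<comment> \<open>A zero row \<open>c\<close> of \<open>C\<close> has \<open>f c = nc\<close> and
    gives a zero column of \<open>R\<close>; every other column of \<open>R\<close> selects a pivot
    column. So \<open>C * R\<close> is the diagonal matrix marking the nonzero rows of
    \<open>C\<close>, and multiplying by it leaves \<open>C\<close> unchanged.\<close>
  have CR: "(C * R) $$ (r, c) = (if r = c \<and> f c < nc then 1 else 0)"
    if r: "r < nr" and c: "c < nr" for r c
  proof -
    have "(C * R) $$ (r, c) = (\<Sum>k<nc. C $$ (r, k) * (if f c = k then 1 else 0))"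
      using C R r c by (simp add: scalar_prod_def R_def atLeast0LessThan)
    also have "\<dots> = (if f c < nc then C $$ (r, f c) else 0)"
      by (simp add: if_distrib[of "\<lambda>x. _ * x"] sum.delta' cong: if_cong)
    also have "\<dots> = (if r = c \<and> f c < nc then 1 else 0)"
      using p(4)[OF c] p(5)[OF c _ r] by auto
    finally show ?thesis .
  qed
  have CRC: "C * R * C = C"
  proof (rule eq_matI)
    fix r c assume "r < dim_row C" "c < dim_col C"
    hence r: "r < nr" and c: "c < nc" using C by auto
    have "(K * C) $$ (r, c) = (\<Sum>k<nr. K $$ (r, k) * C $$ (k, c))"
      if "K \<in> carrier_mat nr nr" for K
      using that C r c by (simp add: scalar_prod_def atLeast0LessThan)
    hence "(C * R * C) $$ (r, c) = (\<Sum>k<nr. (C * R) $$ (r, k) * C $$ (k, c))"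
      using mult_carrier_mat[OF C R] by blast
    also have "\<dots> = (\<Sum>k<nr. if k = r then (if f r < nc then C $$ (r, c) else 0) else 0)"
      by (rule sum.cong) (auto simp: CR r)
    also have "\<dots> = (if f r < nc then C $$ (r, c) else 0)" using r by simp
    also have "\<dots> = C $$ (r, c)"
      using p(1)[OF r] p(2)[OF r, of c] c by auto
    finally show "(C * R * C) $$ (r, c) = C $$ (r, c)" .
  qed (use C R in auto)
  have A_QC: "A = Q * C"
    unfolding CPA using A P Q QP by (simp flip: mult_assoc_dim)
  \<comment> \<open>Folding \<open>P * A\<close> into \<open>C\<close> leaves
    \<open>A * R * C\<close>; the remaining \<open>A\<close> is then replaced by
    \<open>Q * C\<close>.\<close>
  have "A * (R * P) * A = Q * (C * R * C)"
    using A P Q R C by (simp add: mult_assoc_dim CPA[symmetric])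
      (simp add: A_QC mult_assoc_dim)
  also have "\<dots> = A" by (simp add: CRC A_QC)
  finally show ?thesis using R P by (intro bexI[of _ "R * P"]) auto
qed

text \<open>Multiplying the premise by Z^T from the left gives (A Z)^T (A Z) = 0. Its diagonal
  entries are the sums of squares of the columns of A Z, which over the reals vanish only
  termwise.\<close>

lemma gram_mult_eq_0:
  fixes A :: "real mat"
  assumes A: "A \<in> carrier_mat n m" and Z: "Z \<in> carrier_mat m k"
    and 0: "transpose_mat A * (A * Z) = 0\<^sub>m m k"
  shows "A * Z = 0\<^sub>m n k"
proof (rule eq_matI)
  fix r c assume "r < dim_row (0\<^sub>m n k :: real mat)" "c < dim_col (0\<^sub>m n k :: real mat)"
  hence r: "r < n" and c: "c < k" by auto
  have "transpose_mat (A * Z) * (A * Z) = transpose_mat Z * (transpose_mat A * (A * Z))"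
    using A Z by (simp add: transpose_mult_dim mult_assoc_dim)
  also have "\<dots> = 0\<^sub>m k k" using Z by (simp add: 0)
  finally have "(transpose_mat (A * Z) * (A * Z)) $$ (c, c) = 0" using c by simp
  hence "col (A * Z) c \<bullet> col (A * Z) c = 0" using A Z c by simp
  hence "(\<Sum>j<n. ((A * Z) $$ (j, c))\<^sup>2) = 0"
    using A Z c by (simp add: scalar_prod_def atLeast0LessThan power2_eq_square)
  hence "(A * Z) $$ (r, c) = 0" using r by (simp add: sum_nonneg_eq_0_iff)
  thus "(A * Z) $$ (r, c) = 0\<^sub>m n k $$ (r, c)" using r c by simp
qed (use A Z in auto)

text \<open>Take an inner inverse S of M = A^T A. Then M annihilates S M - I, hence so does A, which
  means A S M = A. As M is symmetric, transposing this exhibits S^T A^T as a solution.\<close>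

lemma normal_equation_solvable:
  fixes A :: "real mat"
  assumes A: "A \<in> carrier_mat n m"
  shows "\<exists>X \<in> carrier_mat m n. transpose_mat A * A * X = transpose_mat A"
proof -
  define M where "M = transpose_mat A * A"
  have M: "M \<in> carrier_mat m m" using A unfolding M_def by simp
  obtain S where S: "S \<in> carrier_mat m m" and MSM: "M * S * M = M"
    using inner_inverse_exists[OF M] by blast
  define Z where "Z = S * M - 1\<^sub>m m"
  have Z: "Z \<in> carrier_mat m m" using S M unfolding Z_def by (intro carrier_matI) auto
  have "transpose_mat A * (A * Z) = M * Z"
    using A Z unfolding M_def by (simp add: mult_assoc_dim)
  also have "\<dots> = M * S * M - M"
    using M S unfolding Z_def by (simp add: mult_minus_dim mult_assoc_dim)
  also have "\<dots> = 0\<^sub>m m m" using M by (simp add: MSM)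
  finally have "A * Z = 0\<^sub>m n m" by (rule gram_mult_eq_0[OF A Z])
  moreover have "A * Z = A * (S * M) - A"
    using A M S unfolding Z_def by (simp add: mult_minus_dim)
  ultimately have "A * (S * M) = A"
    using minus_mat_eq_0_iff[of "A * (S * M)" n m A] A S M by simp
  hence "transpose_mat (A * (S * M)) = transpose_mat A" by simp
  hence "transpose_mat A * A * (transpose_mat S * transpose_mat A) = transpose_mat A"
    using A S unfolding M_def by (simp add: transpose_mult_dim mult_assoc_dim)
  thus ?thesis using A S by (intro bexI[of _ "transpose_mat S * transpose_mat A"]) auto
qed

text \<open>A solution X of the normal equations works: transposing them gives X^T A^T A = A, so
  that (A X)^T = X^T A^T A X = A X.\<close>

lemma one_three_inverse_exists:
  fixes A :: "real mat"
  assumes A: "A \<in> carrier_mat n m"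
  shows "\<exists>X \<in> carrier_mat m n. A * X * A = A \<and> transpose_mat (A * X) = A * X"
proof -
  obtain X where X: "X \<in> carrier_mat m n" and eq: "transpose_mat A * A * X = transpose_mat A"
    using normal_equation_solvable[OF A] by blast
  have "transpose_mat (transpose_mat A * A * X) = A" by (simp add: eq)
  hence eq': "transpose_mat X * (transpose_mat A * A) = A"
    using A X by (simp add: transpose_mult_dim)
  have "transpose_mat (A * X) = transpose_mat X * (transpose_mat A * A * X)"
    using A X by (simp add: eq transpose_mult_dim)
  also have "\<dots> = transpose_mat X * (transpose_mat A * A) * X"
    using A X by (simp add: mult_assoc_dim)
  also have "\<dots> = A * X" by (simp add: eq')
  finally have sym: "transpose_mat (A * X) = A * X" .
  have "A * X * A = transpose_mat (A * X) * A" by (simp add: sym)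
  also have "\<dots> = A" using A X eq' by (simp add: transpose_mult_dim mult_assoc_dim)
  finally show ?thesis using X sym by blast
qed

text \<open>The previous lemma, applied to A and to A^T, gives inner inverses X and Y of A with A X
  and Y A symmetric. The pseudoinverse is Y A X, because A (Y A X) = A X and (Y A X) A = Y
  A.\<close>

lemma moore_penrose_exists: "\<exists>X. is_moore_penrose A X"
proof -
  define n m where "n = dim_row A" and "m = dim_col A"
  have A: "A \<in> carrier_mat n m" unfolding n_def m_def by simp
  obtain X where X: "X \<in> carrier_mat m n" and AXA: "A * X * A = A"
    and symX: "transpose_mat (A * X) = A * X"
    using one_three_inverse_exists[OF A] by blast
  obtain V where V: "V \<in> carrier_mat n m"
    and AVA: "transpose_mat A * V * transpose_mat A = transpose_mat A"
    and symV: "transpose_mat (transpose_mat A * V) = transpose_mat A * V"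
    using one_three_inverse_exists[of "transpose_mat A" m n] A by auto
  define Y where "Y = transpose_mat V"
  have Y: "Y \<in> carrier_mat m n" using V unfolding Y_def by simp
  have symY: "transpose_mat (Y * A) = Y * A"
    using symV A V by (simp add: Y_def transpose_mult_dim)
  have "transpose_mat (transpose_mat A * V * transpose_mat A) = A" by (simp add: AVA)
  hence AYA: "A * (Y * A) = A" using A V by (simp add: Y_def transpose_mult_dim)
  have AXA: "A * (X * A) = A" using AXA A X by (simp add: mult_assoc_dim)
  have AYAX: "A * (Y * (A * X)) = A * X"
    using arg_cong[OF AYA, of "\<lambda>M. M * X"] A X Y by (simp add: mult_assoc_dim)
  \<comment> \<open>\<open>A X\<close> and \<open>Y A\<close> are the orthogonal projections onto the column and the row space.\<close>
  have "is_moore_penrose A (Y * (A * X))"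
    unfolding is_moore_penrose_def
  proof (intro conjI)
    show "Y * (A * X) \<in> carrier_mat (dim_col A) (dim_row A)" using A X Y by simp
    show "A * (Y * (A * X)) * A = A"
      using A X Y by (simp add: AYAX AXA mult_assoc_dim)
    have "A * (X * (A * (Y * (A * X)))) = A * X"
      using arg_cong[OF AXA, of "\<lambda>M. M * X"] A X Y by (simp add: AYAX mult_assoc_dim)
    thus "Y * (A * X) * A * (Y * (A * X)) = Y * (A * X)"
      using A X Y by (simp add: mult_assoc_dim)
    show "transpose_mat (A * (Y * (A * X))) = A * (Y * (A * X))"
      using symX by (simp add: AYAX)
    show "transpose_mat (Y * (A * X) * A) = Y * (A * X) * A"
      using symY A X Y AXA by (simp add: mult_assoc_dim)
  qed
  thus ?thesis by blast
qed

text \<open>Symmetry lets the factors of A Y A X be exchanged, so A X = A Y, and likewise X A = Y A.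
  Then X = X A X = Y A X = Y A Y = Y.\<close>

lemma moore_penrose_unique:
  assumes X: "is_moore_penrose A X" and Y: "is_moore_penrose A Y"
  shows "X = Y"
proof -
  note d = is_moore_penrose_def
  have sym: "transpose_mat (A * X) = A * X" "transpose_mat (X * A) = X * A"
      "transpose_mat (A * Y) = A * Y" "transpose_mat (Y * A) = Y * A"
    using X Y unfolding d by auto
  have dX: "dim_row X = dim_col A" "dim_col X = dim_row A"
    and dY: "dim_row Y = dim_col A" "dim_col Y = dim_row A"
    using X Y unfolding d by auto
  have "A * X = A * Y * A * X" using Y unfolding d by simp
  also have "\<dots> = transpose_mat (A * Y) * transpose_mat (A * X)"
    using dX dY by (simp only: sym) (simp add: mult_assoc_dim)
  also have "\<dots> = transpose_mat (A * X * A * Y)"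
    using dX dY by (simp add: transpose_mult_dim mult_assoc_dim)
  also have "\<dots> = A * Y" using X Y unfolding d by simp
  finally have AX: "A * X = A * Y" .
  have "X * A = X * (A * Y * A)" using Y unfolding d by simp
  also have "\<dots> = transpose_mat (X * A) * transpose_mat (Y * A)"
    using dX dY by (simp only: sym) (simp add: mult_assoc_dim)
  also have "\<dots> = transpose_mat (Y * (A * X * A))"
    using dX dY by (simp add: transpose_mult_dim mult_assoc_dim)
  also have "\<dots> = Y * A" using X Y unfolding d by simp
  finally have XA: "X * A = Y * A" .
  have "X = X * A * X" using X unfolding d by simp
  also have "\<dots> = Y * A * Y" using dX dY by (simp add: XA) (simp add: mult_assoc_dim AX)
  also have "\<dots> = Y" using Y unfolding d by simp
  finally show ?thesis .
qed

lemma pinv_eqI: "is_moore_penrose A X \<Longrightarrow> pinv A = X"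
  unfolding pinv_def by (rule the_equality) (auto intro: moore_penrose_unique)

lemma pinv_moore_penrose: "is_moore_penrose A (pinv A)"
  using moore_penrose_exists[of A] pinv_eqI by metis

lemma pinv_dim [simp]: "dim_row (pinv A) = dim_col A" "dim_col (pinv A) = dim_row A"
  using pinv_moore_penrose[of A] unfolding is_moore_penrose_def by auto

lemma pinv_carrier: "A \<in> carrier_mat n m \<Longrightarrow> pinv A \<in> carrier_mat m n"
  by auto

text \<open>Products nest to the right here, the form that \<open>mult_assoc_dim\<close>
  produces.\<close>

lemma
  shows mult_pinv_mult: "A * (pinv A * A) = A"
    and pinv_mult_pinv: "pinv A * (A * pinv A) = pinv A"
    and transpose_mult_pinv: "transpose_mat (A * pinv A) = A * pinv A"
    and transpose_pinv_mult: "transpose_mat (pinv A * A) = pinv A * A"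
  using pinv_moore_penrose[of A] unfolding is_moore_penrose_def by (simp_all add: mult_assoc_dim)

section \<open>Full row rank and right inverses\<close>

lemma pinv_eqI_right_inverse:
  assumes "A \<in> carrier_mat n m" "X \<in> carrier_mat m n"
    and "A * X = 1\<^sub>m n" "transpose_mat (X * A) = X * A"
  shows "pinv A = X"
  using assms by (intro pinv_eqI) (auto simp: is_moore_penrose_def mult_assoc_dim)

text \<open>A maximal independent set of columns has as many elements as the rank. Here these are n
  independent vectors in dimension n, hence a basis, so the columns span the whole space.\<close>

lemma full_row_rank_surj:
  fixes W :: "'a :: field mat"
  assumes W: "W \<in> carrier_mat n q" and rk: "vec_space.rank n W = n"
    and v: "v \<in> carrier_vec n"
  shows "\<exists>x \<in> carrier_vec q. W *\<^sub>v x = v"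
proof -
  interpret vec_space "TYPE('a)" n .
  have cols: "set (cols W) \<subseteq> carrier_vec n" using cols_dim W by blast
  obtain S where S: "maximal S (\<lambda>T. T \<subseteq> set (cols W) \<and> lin_indpt T)"
    using maximal_exists_superset[of "set (cols W)" "\<lambda>T. T \<subseteq> set (cols W) \<and> lin_indpt T" "{}"]
      lindep_span by (auto simp: lin_dep_def)
  have card: "card S = n" using rank_card_indpt[OF W S] rk by simp
  have SW: "S \<subseteq> set (cols W)" and li: "lin_indpt S" using S unfolding maximal_def by auto
  have "basis S"
    using SW li cols card finite_subset[OF SW] by (intro dim_li_is_basis) (auto simp: dim_is_n)
  hence "span S = carrier_vec n" unfolding basis_def by simp
  with span_is_monotone[OF SW] v have "v \<in> col_space W" unfolding col_space_def by auto
  thus ?thesis using W unfolding col_space_eq[OF W] by auto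
qed

text \<open>Each unit vector has the form W x, and \<open>W * pinv W\<close> fixes every such vector
  because \<open>W * pinv W * W = W\<close>.\<close>

lemma full_row_rank_mult_pinv:
  assumes W: "W \<in> carrier_mat n q" and rk: "vec_space.rank n W = n"
  shows "W * pinv W = 1\<^sub>m n"
proof (rule eq_matI)
  fix r c assume "r < dim_row (1\<^sub>m n :: real mat)" "c < dim_col (1\<^sub>m n :: real mat)"
  hence r: "r < n" and c: "c < n" by auto
  obtain x where x: "x \<in> carrier_vec q" and Wx: "W *\<^sub>v x = unit_vec n c"
    using full_row_rank_surj[OF W rk, of "unit_vec n c"] by auto
  have "W * pinv W *\<^sub>v unit_vec n c = W * pinv W * W *\<^sub>v x"
    using W x by (simp add: Wx[symmetric] mult_assoc_vec_dim)
  also have "\<dots> = unit_vec n c" using W by (simp add: mult_assoc_dim mult_pinv_mult Wx)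
  finally have "(W * pinv W *\<^sub>v unit_vec n c) $ r = unit_vec n c $ r" by simp
  moreover have "(W * pinv W *\<^sub>v unit_vec n c) $ r = (W * pinv W) $$ (r, c)"
    using W r c by simp
  ultimately show "(W * pinv W) $$ (r, c) = 1\<^sub>m n $$ (r, c)" using r c by simp
qed (use W in auto)

section \<open>The penalized coefficients for a design of full row rank\<close>

text \<open>Full row rank lets every response be fitted exactly. Hence, once tau is chosen, lambda
  is the least-norm solution of A lambda = z - S tau; this ties the two separate closed forms
  together.\<close>

lemma prls_lambda_full_row_rank:
  assumes A: "A \<in> carrier_mat n q" and S: "S \<in> carrier_mat n m" and z: "z \<in> carrier_vec n"
    and right_inv: "A * pinv A = 1\<^sub>m n"
  shows "prls_lambda A S z = pinv A *\<^sub>v (z - S *\<^sub>v prls_tau A S z)"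
proof -
  define U where "U = pinv A"
  define B where "B = U * S"
  define K where "K = pinv B"
  define P where "P = proj_perp S"
  define Z where "Z = U - B * (K * U)"
  have U: "U \<in> carrier_mat q n" using A unfolding U_def by auto
  have B: "B \<in> carrier_mat q m" using U S unfolding B_def by auto
  have K: "K \<in> carrier_mat m q" using B unfolding K_def by auto
  have P: "P \<in> carrier_mat n n" using S unfolding P_def proj_perp_def by (intro carrier_matI) auto
  have Z: "Z \<in> carrier_mat q n" using U B K unfolding Z_def by (intro carrier_matI) auto
  have AU: "A * U = 1\<^sub>m n" unfolding U_def by (rule right_inv)
  have BKB: "B * (K * B) = B" unfolding K_def by (rule mult_pinv_mult)
  have P_eq: "P = 1\<^sub>m n - S * pinv S" using S unfolding P_def proj_perp_def by simp
  have PS: "P * S = 0\<^sub>m n m"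
    using S by (simp add: P_eq dim_simps mult_pinv_mult)
  have ZS: "Z * S = 0\<^sub>m q m"
    using U B K S BKB by (simp add: Z_def dim_simps B_def[symmetric])
  have PP: "P * P = P"
  proof -
    have "P * P = P * (1\<^sub>m n - S * pinv S)" by (simp add: P_eq)
    also have "\<dots> = P - P * S * pinv S" using P S by (simp add: mult_minus_dim mult_assoc_dim)
    finally have "P * P = P - P * S * pinv S" .
    thus ?thesis using P S by (simp add: PS minus_zero_dim)
  qed
  have ZP: "Z * P = Z"
  proof -
    have "Z * P = Z - Z * S * pinv S"
      using Z S by (simp add: P_eq mult_minus_dim mult_assoc_dim)
    thus ?thesis using Z S by (simp add: ZS minus_zero_dim)
  qed
  have P_sym: "transpose_mat P = P"
    using S transpose_mult_pinv[of S] by (simp add: P_eq transpose_minus_dim)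
  \<comment> \<open>\<open>U * A\<close> projects onto the row space of \<open>A\<close>, which
    contains the columns of \<open>B = U * S\<close>. Hence it fixes \<open>B * K\<close>; as both
    projections are symmetric, transposing gives the product in the other order.\<close>
  have "U * A * (B * K) = U * (A * U) * (S * K)"
    using A U B K S by (simp add: B_def mult_assoc_dim)
  hence UABK: "U * A * (B * K) = B * K"
    using U S K by (simp add: AU B_def dim_simps)
  have BKUA: "B * K * (U * A) = B * K"
    using arg_cong[OF UABK, of transpose_mat] A U B K
      transpose_mult_pinv[of B] transpose_pinv_mult[of A]
    by (simp add: transpose_mult_dim[of "U * A" "B * K"] K_def[symmetric] U_def[symmetric])
  have ZA: "Z * A = U * A - B * K"
    using A U B K BKUA by (simp add: Z_def dim_simps)
  have ZA_sym: "transpose_mat (Z * A) = Z * A"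
    using A U B K transpose_mult_pinv[of B] transpose_pinv_mult[of A]
    by (simp add: ZA transpose_minus_dim K_def[symmetric] U_def[symmetric])
  \<comment> \<open>Since \<open>A * B = S\<close>, the matrix \<open>A * Z\<close> differs from the
    identity only by a multiple of \<open>S\<close>, which \<open>P\<close> annihilates.\<close>
  have "A * (B * (K * U)) = A * U * (S * (K * U))"
    using A U S K by (simp add: B_def mult_assoc_dim)
  hence AZ: "A * Z = 1\<^sub>m n - S * (K * U)"
    using A U B K S by (simp add: Z_def mult_minus_dim AU)
  have "P * (A * Z) = P - P * S * (K * U)"
    using P S K U by (simp add: AZ dim_simps)
  hence PAZ: "P * (A * Z) = P" using P K U by (simp add: PS minus_zero_dim)
  \<comment> \<open>\<open>Z = (I - B B\<^sup>+) A\<^sup>+\<close> is the pseudoinverse of \<open>P A\<close>, since \<open>Z P = Z\<close> and \<open>P A Z = P\<close>.\<close>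
  have "is_moore_penrose (P * A) Z"
    unfolding is_moore_penrose_def
  proof (intro conjI)
    show "Z \<in> carrier_mat (dim_col (P * A)) (dim_row (P * A))" using Z P A by simp
    have "P * A * Z * (P * A) = P * (A * Z) * (P * A)" using P A Z by (simp add: mult_assoc_dim)
    also have "\<dots> = P * P * A" using P A by (simp only: PAZ) (simp add: mult_assoc_dim)
    finally show "P * A * Z * (P * A) = P * A" by (simp add: PP)
    have "Z * (P * A) * Z = Z * P * A * Z" using P A Z by (simp add: mult_assoc_dim)
    also have "\<dots> = Z * P * (A * Z)" using P A Z by (simp add: mult_assoc_dim)
    also have "\<dots> = Z * (P * (A * Z))" using P A Z by (simp add: mult_assoc_dim)
    finally show "Z * (P * A) * Z = Z" by (simp add: PAZ ZP)
    have "P * A * Z = P" using P A Z PAZ by (simp add: mult_assoc_dim)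
    thus "transpose_mat (P * A * Z) = P * A * Z" by (simp add: P_sym)
    have "Z * (P * A) = Z * P * A" using P A Z by (simp add: mult_assoc_dim)
    thus "transpose_mat (Z * (P * A)) = Z * (P * A)" by (simp add: ZP ZA_sym)
  qed
  hence "pinv (P * A) = Z" by (rule pinv_eqI)
  hence "prls_lambda A S z = Z *\<^sub>v (P *\<^sub>v z)"
    unfolding prls_lambda_def P_def by simp
  also have "\<dots> = Z * P *\<^sub>v z" using Z P z by (simp add: mult_assoc_vec_dim)
  also have "\<dots> = Z *\<^sub>v z" by (simp add: ZP)
  also have "\<dots> = U *\<^sub>v z - U *\<^sub>v (S *\<^sub>v (K *\<^sub>v (U *\<^sub>v z)))"
    using U B K S z by (simp add: Z_def minus_mult_vec_dim B_def mult_assoc_vec_dim)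
  also have "\<dots> = U *\<^sub>v (z - S *\<^sub>v (K *\<^sub>v (U *\<^sub>v z)))"
    using U K S z by (simp add: mult_minus_vec_dim)
  finally show ?thesis unfolding prls_tau_def U_def B_def K_def .
qed

section \<open>Deleting a row\<close>

lemma delete_row_carrier: "A \<in> carrier_mat n m \<Longrightarrow> delete_row i A \<in> carrier_mat (n - 1) m"
  unfolding delete_row_def by auto

text \<open>Deletion becomes left multiplication by the identity without its \<open>i\<close>-th
  row, so that it can take part in matrix algebra.\<close>

lemma delete_row_one_mult:
  fixes A :: "'a :: semiring_1 mat"
  assumes "A \<in> carrier_mat n m" "i < n"
  shows "delete_row i (1\<^sub>m n) * A = delete_row i A"
proof (rule eq_matI)
  fix r c assume "r < dim_row (delete_row i A)" "c < dim_col (delete_row i A)"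
  hence r: "r < n - 1" and c: "c < m" using assms by (auto simp: delete_row_def)
  define k where "k = (if r < i then r else Suc r)"
  have k: "k < n" using r unfolding k_def by auto
  have "row (delete_row i (1\<^sub>m n) :: 'a mat) r = unit_vec n k"
    using r k by (intro eq_vecI) (auto simp: delete_row_def k_def)
  moreover have "dim_row (delete_row i (1\<^sub>m n) :: 'a mat) = n - 1"
    "dim_col (delete_row i (1\<^sub>m n) :: 'a mat) = n"
    by (simp_all add: delete_row_def)
  moreover have "delete_row i A $$ (r, c) = A $$ (k, c)"
    using assms r c by (simp add: delete_row_def k_def)
  ultimately show "(delete_row i (1\<^sub>m n) * A) $$ (r, c) = delete_row i A $$ (r, c)"
    using assms r c k by simp
qed (use assms in \<open>auto simp: delete_row_def\<close>)

lemma delete_row_one_mult_vec: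
  fixes v :: "'a :: semiring_1 vec"
  assumes "v \<in> carrier_vec n" "i < n"
  shows "delete_row i (1\<^sub>m n) *\<^sub>v v = delete_entry i v"
proof (rule eq_vecI)
  fix r assume "r < dim_vec (delete_entry i v)"
  hence r: "r < n - 1" using assms by (auto simp: delete_entry_def)
  define k where "k = (if r < i then r else Suc r)"
  have k: "k < n" using r unfolding k_def by auto
  have "row (delete_row i (1\<^sub>m n) :: 'a mat) r = unit_vec n k"
    using r k by (intro eq_vecI) (auto simp: delete_row_def k_def)
  moreover have "dim_row (delete_row i (1\<^sub>m n) :: 'a mat) = n - 1"
    "dim_col (delete_row i (1\<^sub>m n) :: 'a mat) = n"
    by (simp_all add: delete_row_def)
  moreover have "delete_entry i v $ r = v $ k"
    using assms r by (simp add: delete_entry_def k_def)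
  ultimately show "(delete_row i (1\<^sub>m n) *\<^sub>v v) $ r = delete_entry i v $ r"
    using assms r k by simp
qed (use assms in \<open>auto simp: delete_row_def delete_entry_def\<close>)

text \<open>This is e_i e_i^T. In diagonal form, multiplying by it just scales rows or
  columns.\<close>

definition coord_proj :: "nat \<Rightarrow> nat \<Rightarrow> 'a :: {zero, one} mat" where
  "coord_proj n i = mat_diag n (\<lambda>j. if j = i then 1 else 0)"

lemma coord_proj_carrier [simp]: "coord_proj n i \<in> carrier_mat n n"
  unfolding coord_proj_def by simp

lemma coord_proj_dim [simp]: "dim_row (coord_proj n i) = n" "dim_col (coord_proj n i) = n"
  unfolding coord_proj_def mat_diag_def by auto

lemma transpose_coord_proj: "transpose_mat (coord_proj n i) = coord_proj n i"
  unfolding coord_proj_def mat_diag_def by (rule eq_matI) auto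

lemma coord_proj_conj:
  fixes A :: "'a :: comm_semiring_1 mat"
  assumes "A \<in> carrier_mat n n" "i < n"
  shows "coord_proj n i * A * coord_proj n i = A $$ (i, i) \<cdot>\<^sub>m coord_proj n i"
proof -
  have "coord_proj n i * A = mat n n (\<lambda>(r, c). (if r = i then 1 else 0) * A $$ (r, c))"
    unfolding coord_proj_def by (rule mat_diag_mult_left[OF assms(1)])
  thus ?thesis
    unfolding coord_proj_def using assms(2)
    by (subst mat_diag_mult_right[of _ n]) (auto simp: mat_diag_def intro!: eq_matI)
qed

lemma unit_vec_outer_product:
  "mat_of_cols n [unit_vec n i] * transpose_mat (mat_of_cols n [unit_vec n i]) =
    (coord_proj n i :: 'a :: semiring_1 mat)"
  unfolding coord_proj_def mat_diag_def
  by (rule eq_matI) (auto simp: scalar_prod_def mat_of_cols_def unit_vec_def)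

lemma coord_proj_mult_vec_index:
  fixes v :: "'a :: semiring_1 vec"
  assumes "v \<in> carrier_vec n" "i < n"
  shows "(coord_proj n i *\<^sub>v v) $ i = v $ i"
proof -
  have "row (coord_proj n i :: 'a mat) i = unit_vec n i"
    using assms by (intro eq_vecI) (auto simp: coord_proj_def mat_diag_def)
  thus ?thesis using assms by simp
qed

text \<open>The rows of D are the unit vectors other than e_i: they are orthonormal, they are
  orthogonal to e_i, and D^T D projects onto their span.\<close>

lemma delete_row_one_gram:
  fixes D :: "'a :: comm_ring_1 mat"
  assumes i: "i < n"
  defines "D \<equiv> delete_row i (1\<^sub>m n)"
  shows "D * transpose_mat D = 1\<^sub>m (n - 1)"
    and "transpose_mat D * D = 1\<^sub>m n - coord_proj n i"
    and "D * coord_proj n i = 0\<^sub>m (n - 1) n"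
proof -
  have D: "D \<in> carrier_mat (n - 1) n" unfolding D_def by (intro delete_row_carrier) simp
  have "D * transpose_mat D = delete_row i (transpose_mat D)"
    unfolding D_def by (rule delete_row_one_mult) (use i in \<open>auto simp: delete_row_def\<close>)
  also have "\<dots> = 1\<^sub>m (n - 1)"
    using i by (intro eq_matI) (auto simp: delete_row_def D_def)
  finally show "D * transpose_mat D = 1\<^sub>m (n - 1)" .
  have "D * coord_proj n i = delete_row i (coord_proj n i)"
    unfolding D_def by (rule delete_row_one_mult) (use i in auto)
  also have "\<dots> = 0\<^sub>m (n - 1) n"
    by (intro eq_matI) (auto simp: delete_row_def coord_proj_def mat_diag_def)
  finally show DN: "D * coord_proj n i = 0\<^sub>m (n - 1) n" .
  show "transpose_mat D * D = 1\<^sub>m n - coord_proj n i"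
  proof (rule eq_matI)
    fix r c assume "r < dim_row (1\<^sub>m n - coord_proj n i :: 'a mat)"
      "c < dim_col (1\<^sub>m n - coord_proj n i :: 'a mat)"
    hence r: "r < n" and c: "c < n" by auto
    \<comment> \<open>\<open>s\<close> enumerates the indices other than \<open>i\<close>, so
      reindexing turns the sum over the rows of \<open>D\<close> into a sum over all indices except
      \<open>i\<close>.\<close>
    define s where "s = (\<lambda>k :: nat. if k < i then k else Suc k)"
    have "bij_betw s {..<n - 1} ({..<n} - {i})"
      using i by (intro bij_betwI[where g = "\<lambda>k. if k < i then k else k - 1"])
        (auto simp: s_def split: if_splits)
    hence "(\<Sum>k<n - 1. (if s k = r then 1 else 0) * (if s k = c then 1 else 0)) =
        (\<Sum>j\<in>{..<n} - {i}. (if j = r then 1 else 0) * (if j = c then 1 else 0 :: 'a))"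
      by (rule sum.reindex_bij_betw)
    also have "\<dots> = (\<Sum>j\<in>{..<n} - {i}. if j = r then (if r = c then 1 else 0) else 0)"
      by (rule sum.cong) auto
    also have "\<dots> = (1\<^sub>m n - coord_proj n i) $$ (r, c)"
      using r c by (auto simp: coord_proj_def mat_diag_def)
    finally have sum: "(\<Sum>k<n - 1. (if s k = r then 1 else 0) * (if s k = c then 1 else 0)) =
        (1\<^sub>m n - coord_proj n i :: 'a mat) $$ (r, c)" .
    have "(transpose_mat D * D) $$ (r, c) = (\<Sum>k<n - 1. D $$ (k, r) * D $$ (k, c))"
      using D r c by (simp add: scalar_prod_def atLeast0LessThan)
    also have "\<dots> = (\<Sum>k<n - 1. (if s k = r then 1 else 0) * (if s k = c then 1 else 0))"
      using r c by (intro sum.cong) (auto simp: D_def delete_row_def s_def)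
    also note sum
    finally show "(transpose_mat D * D) $$ (r, c) = (1\<^sub>m n - coord_proj n i) $$ (r, c)" .
  qed (use D in auto)
qed

section \<open>The leave-one-out pseudoinverse\<close>

text \<open>With U = \<open>pinv W\<close>, symmetry of U W gives W W^T U^T U = W (U W) U = I, so
  U^T U is even the inverse of W W^T.\<close>

lemma gram_pinv_full_row_rank:
  assumes W: "W \<in> carrier_mat n q" and right_inv: "W * pinv W = 1\<^sub>m n"
  shows "gram_pinv W = transpose_mat (pinv W) * pinv W"
proof -
  define U where "U = pinv W"
  have U: "U \<in> carrier_mat q n" using W unfolding U_def by auto
  have WU: "W * U = 1\<^sub>m n" unfolding U_def by (rule right_inv)
  have UW: "transpose_mat W * transpose_mat U = U * W"
    using transpose_pinv_mult[of W] W U by (simp add: U_def transpose_mult_dim)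
  have "W * transpose_mat W * (transpose_mat U * U) = W * (transpose_mat W * transpose_mat U) * U"
    using W U by (simp add: mult_assoc_dim)
  also have "\<dots> = W * U * (W * U)" using W U by (simp only: UW) (simp add: mult_assoc_dim)
  finally have 1: "W * transpose_mat W * (transpose_mat U * U) = 1\<^sub>m n" by (simp add: WU)
  have 2: "transpose_mat U * U * (W * transpose_mat W) = 1\<^sub>m n"
    using arg_cong[OF 1, of transpose_mat] W U by (simp add: transpose_mult_dim)
  show ?thesis
    unfolding gram_pinv_def U_def[symmetric]
    by (rule pinv_eqI_right_inverse[of _ n n]) (use W U in \<open>auto simp only: 1 2 transpose_one\<close>, use W U in auto)
qed

text \<open>The entry is the squared norm of the \<open>j\<close>-th column of
  \<open>pinv W\<close>, which is nonzero because its product with the \<open>j\<close>-th row of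
  \<open>W\<close> is 1.\<close>

lemma gram_pinv_diag_pos:
  assumes W: "W \<in> carrier_mat n q" and right_inv: "W * pinv W = 1\<^sub>m n" and j: "j < n"
  shows "gram_pinv W $$ (j, j) > 0"
proof -
  have "(\<Sum>k<q. W $$ (j, k) * pinv W $$ (k, j)) = (W * pinv W) $$ (j, j)"
    using W j by (simp add: scalar_prod_def atLeast0LessThan)
  hence "(\<Sum>k<q. W $$ (j, k) * pinv W $$ (k, j)) \<noteq> 0" using right_inv j by simp
  then obtain k where k: "k < q" "pinv W $$ (k, j) \<noteq> 0"
    by (metis (no_types, lifting) lessThan_iff mult_zero_right sum.neutral)
  have "0 < (\<Sum>k<q. (pinv W $$ (k, j))\<^sup>2)"
    by (rule sum_pos2[of _ k]) (use k in auto)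
  also have "\<dots> = gram_pinv W $$ (j, j)"
    unfolding gram_pinv_full_row_rank[OF W right_inv]
    using W j by (simp add: scalar_prod_def atLeast0LessThan power2_eq_square)
  finally show ?thesis .
qed

lemma W_tilde_eq:
  assumes W: "W \<in> carrier_mat n q" and right_inv: "W * pinv W = 1\<^sub>m n" and i: "i < n"
  defines "G \<equiv> gram_pinv W"
  shows "W_tilde W i = pinv W - (1 / G $$ (i, i)) \<cdot>\<^sub>m (pinv W * (coord_proj n i * G))"
proof -
  define U where "U = pinv W"
  define E :: "real mat" where "E = mat_of_cols n [unit_vec n i]"
  have U: "U \<in> carrier_mat q n" using W unfolding U_def by auto
  have E: "E \<in> carrier_mat n 1" unfolding E_def by auto
  have G_eq: "G = transpose_mat U * U"
    unfolding G_def U_def by (rule gram_pinv_full_row_rank[OF W right_inv])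
  have G: "G \<in> carrier_mat n n" unfolding G_eq using U by simp
  have g: "unit_vec n i \<bullet> (G *\<^sub>v unit_vec n i) = G $$ (i, i)"
    using G i by simp
  have EE: "U * E * transpose_mat E = U * coord_proj n i"
    using U E unit_vec_outer_product[of n i, where 'a = real] by (simp add: mult_assoc_dim E_def)
  have "W_tilde W i = (1\<^sub>m q - (1 / G $$ (i, i)) \<cdot>\<^sub>m (U * E * transpose_mat E * transpose_mat U)) * U"
    using W g unfolding W_tilde_def Let_def E_def U_def G_def by simp
  also have "\<dots> = U - (1 / G $$ (i, i)) \<cdot>\<^sub>m (U * (coord_proj n i * G))"
    unfolding EE using U by (simp add: dim_simps G_eq)
  finally show ?thesis unfolding U_def .
qed

text \<open>This yields the leave-one-out prediction: at coordinate \<open>i\<close>, applying the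
  right-hand side to r gives r_i - (G r)_i / G_ii.\<close>

lemma mult_W_tilde:
  assumes W: "W \<in> carrier_mat n q" and right_inv: "W * pinv W = 1\<^sub>m n" and i: "i < n"
  defines "G \<equiv> gram_pinv W"
  shows "W * W_tilde W i = 1\<^sub>m n - (1 / G $$ (i, i)) \<cdot>\<^sub>m (coord_proj n i * G)"
proof -
  have G: "G \<in> carrier_mat n n"
    using W unfolding G_def gram_pinv_def by auto
  have "W * (pinv W * (coord_proj n i * G)) = W * pinv W * (coord_proj n i * G)"
    using W G by (simp add: mult_assoc_dim)
  thus ?thesis
    using W G unfolding W_tilde_eq[OF W right_inv i] G_def[symmetric]
    by (simp add: mult_minus_dim mult_smult_dim right_inv)
qed

text \<open>The vector u = W^+ e_i lies in the row space of W and, as W u = e_i, is orthogonal to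
  all other rows. \<open>W_tilde\<close> removes the direction u from W^+, leaving the row space of
  the reduced matrix.\<close>

lemma pinv_delete_row:
  assumes W: "W \<in> carrier_mat n q" and right_inv: "W * pinv W = 1\<^sub>m n" and i: "i < n"
  defines "D \<equiv> delete_row i (1\<^sub>m n)"
  shows "pinv (delete_row i W) = W_tilde W i * transpose_mat D"
    and "pinv (delete_row i W) * D = W_tilde W i"
    and "delete_row i W * pinv (delete_row i W) = 1\<^sub>m (n - 1)"
proof -
  define U where "U = pinv W"
  define G where "G = gram_pinv W"
  define g where "g = G $$ (i, i)"
  define N :: "real mat" where "N = coord_proj n i"
  define V where "V = W_tilde W i"
  have D: "D \<in> carrier_mat (n - 1) n" unfolding D_def by (intro delete_row_carrier) simp
  have U: "U \<in> carrier_mat q n" using W unfolding U_def by auto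
  have N: "N \<in> carrier_mat n n" unfolding N_def by simp
  have G_eq: "G = transpose_mat U * U"
    unfolding G_def U_def by (rule gram_pinv_full_row_rank[OF W right_inv])
  have G: "G \<in> carrier_mat n n" unfolding G_eq using U by simp
  have g: "g > 0" unfolding g_def G_def by (rule gram_pinv_diag_pos[OF W right_inv i])
  have V_eq: "V = U - (1 / g) \<cdot>\<^sub>m (U * (N * G))"
    unfolding V_def U_def N_def g_def G_def by (rule W_tilde_eq[OF W right_inv i])
  have V: "V \<in> carrier_mat q n" unfolding V_eq using U N G by (intro carrier_matI) auto
  have NGN: "N * (G * N) = g \<cdot>\<^sub>m N"
    using coord_proj_conj[OF G i] G N unfolding N_def g_def by (simp add: mult_assoc_dim)
  \<comment> \<open>The factor \<open>g\<close> from \<open>NGN\<close> cancels against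
    \<open>1 / g\<close>. With \<open>V * N = 0\<close>, passing through
    \<open>transpose_mat D * D\<close>, which is the identity minus \<open>N\<close>, does not
    change \<open>V\<close>.\<close>
  have "V * N = U * N - (1 / g) \<cdot>\<^sub>m (U * (g \<cdot>\<^sub>m N))"
    using U N G unfolding V_eq by (simp add: dim_simps NGN)
  also have "\<dots> = 0\<^sub>m q n"
    using U N g by (simp add: mult_smult_dim) (rule eq_matI, auto)
  finally have VN: "V * N = 0\<^sub>m q n" .
  note gram = delete_row_one_gram[OF i, where 'a = real, folded D_def N_def]
  have DW: "delete_row i W = D * W"
    unfolding D_def by (rule delete_row_one_mult[OF W i, symmetric])
  have VDD: "V * (transpose_mat D * D) = V"
    using V N by (simp add: gram mult_minus_dim VN minus_zero_dim)
  have WV: "W * V = 1\<^sub>m n - (1 / g) \<cdot>\<^sub>m (N * G)"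
    unfolding V_def N_def g_def G_def by (rule mult_W_tilde[OF W right_inv i])
  have "D * (N * G) = D * N * G" using D N G by (simp add: mult_assoc_dim)
  also have "\<dots> = 0\<^sub>m (n - 1) n" using G by (simp add: gram)
  finally have DNG: "D * (N * G) = 0\<^sub>m (n - 1) n" .
  have DWV: "D * (W * V) = D"
    using D N G unfolding WV by (simp add: mult_minus_dim mult_smult_dim DNG)
      (rule eq_matI, auto)
  have right: "D * W * (V * transpose_mat D) = 1\<^sub>m (n - 1)"
  proof -
    have "D * W * (V * transpose_mat D) = D * (W * V) * transpose_mat D"
      using D W V by (simp add: mult_assoc_dim)
    thus ?thesis by (simp add: DWV gram)
  qed
  \<comment> \<open>This rewrites the correction term of \<open>V * W\<close> as a multiple of
    \<open>U * N * transpose_mat U\<close>, which is visibly symmetric.\<close>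
  have "transpose_mat (U * W * U) = transpose_mat U * transpose_mat (U * W)"
    using W U by (intro transpose_mult_dim) auto
  hence UUW: "transpose_mat U * (U * W) = transpose_mat U"
    using W U transpose_pinv_mult[of W] pinv_mult_pinv[of W]
    by (simp add: U_def mult_assoc_dim)
  have VW: "V * W = U * W - (1 / g) \<cdot>\<^sub>m (U * (N * transpose_mat U))"
    using U W N UUW unfolding V_eq G_eq by (simp add: dim_simps)
  have "transpose_mat N = N" unfolding N_def by (rule transpose_coord_proj)
  hence "transpose_mat (U * (N * transpose_mat U)) = U * (N * transpose_mat U)"
    using U N by (simp add: transpose_mult_dim mult_assoc_dim)
  hence VW_sym: "transpose_mat (V * W) = V * W"
    using U W N transpose_pinv_mult[of W]
    unfolding VW U_def[symmetric] by (simp add: transpose_minus_dim transpose_smult)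
  have "V * transpose_mat D * (D * W) = V * (transpose_mat D * D) * W"
    using D W V by (simp add: mult_assoc_dim)
  hence left: "V * transpose_mat D * (D * W) = V * W" by (simp add: VDD)
  show pinv: "pinv (delete_row i W) = W_tilde W i * transpose_mat D"
    unfolding DW V_def[symmetric]
    by (rule pinv_eqI_right_inverse[of _ "n - 1" q])
      (use D W V in \<open>simp_all only: right left VW_sym\<close>, auto)
  show "pinv (delete_row i W) * D = W_tilde W i"
    unfolding pinv V_def[symmetric] using V D VDD by (simp add: mult_assoc_dim)
  show "delete_row i W * pinv (delete_row i W) = 1\<^sub>m (n - 1)"
    unfolding pinv unfolding DW V_def[symmetric] by (rule right)
qed

text \<open>A two-sided inverse rules out the result \<open>None\<close>, and the inverse that is
  returned must agree with B.\<close>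

lemma inv_mat_eqI:
  assumes A: "A \<in> carrier_mat n n" and B: "B \<in> carrier_mat n n"
    and AB: "A * B = 1\<^sub>m n" and BA: "B * A = 1\<^sub>m n"
  shows "inv_mat A = B"
proof -
  have "A \<in> Units (ring_mat TYPE(real) n ())"
    using A B AB BA unfolding Units_def ring_mat_def by auto
  then obtain C where C: "mat_inverse A = Some C"
    using mat_inverse(1)[OF A, of "()"] by fastforce
  from mat_inverse(2)[OF A C] have "C * A = 1\<^sub>m n" and dC: "C \<in> carrier_mat n n" by auto
  hence "B = C * A * B" using B by simp
  also have "\<dots> = C" using A B dC AB by (simp add: mult_assoc_dim)
  finally show ?thesis unfolding inv_mat_def C by simp
qed

section \<open>The leave-one-out residual\<close>

theorem corollary2:
  fixes n q m i :: nat
    and W T :: "real mat"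
    and y :: "real vec"
  assumes "n > 0" and "q > 0" and "m > 0"
    and "W \<in> carrier_mat n q" and "vec_space.rank n W = n" and "n < q"
    and "T \<in> carrier_mat n m" and "vec_space.rank n T = m" and "m < n"
    and "y \<in> carrier_vec n"
    and "i < n"
  shows "loo_residual W T y i =
    unit_vec n i \<bullet>
      ((inv_mat (diag_part (gram_pinv W)) * gram_pinv W * (1\<^sub>m n - H_mat W T i)) *\<^sub>v y)"
proof -
  note W = \<open>W \<in> carrier_mat n q\<close> and T = \<open>T \<in> carrier_mat n m\<close>
    and y = \<open>y \<in> carrier_vec n\<close> and i = \<open>i < n\<close>
  have right_inv: "W * pinv W = 1\<^sub>m n"
    by (rule full_row_rank_mult_pinv) fact+
  define G where "G = gram_pinv W"
  define g where "g = G $$ (i, i)"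
  define D :: "real mat" where "D = delete_row i (1\<^sub>m n)"
  define V where "V = W_tilde W i"
  define X where "X = pinv (delete_row i W)"
  define \<tau> where "\<tau> = prls_tau (delete_row i W) (delete_row i T) (delete_entry i y)"
  define r where "r = y - T *\<^sub>v \<tau>"
  note pinv = pinv_delete_row[OF W right_inv i, folded D_def V_def X_def]
  have D: "D \<in> carrier_mat (n - 1) n" unfolding D_def by (intro delete_row_carrier) simp
  have X: "X \<in> carrier_mat q (n - 1)"
    unfolding X_def by (intro pinv_carrier delete_row_carrier W)
  have V: "V \<in> carrier_mat q n" using pinv(2) X D by auto
  have G: "G \<in> carrier_mat n n" using W unfolding G_def gram_pinv_def by auto
  have g: "G $$ (j, j) > 0" if "j < n" for j
    unfolding G_def by (rule gram_pinv_diag_pos[OF W right_inv that])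
  have DT: "delete_row i T = D * T" unfolding D_def by (rule delete_row_one_mult[OF T i, symmetric])
  have Dy: "delete_entry i y = D *\<^sub>v y"
    unfolding D_def by (rule delete_row_one_mult_vec[OF y i, symmetric])
  \<comment> \<open>\<open>X * D = V\<close> absorbs the deletions, so tau is expressed through the
    full \<open>T\<close> and \<open>y\<close>.\<close>
  have "X * (D * T) = V * T" using X D T pinv(2) by (simp flip: mult_assoc_dim)
  moreover have "X *\<^sub>v (D *\<^sub>v y) = V *\<^sub>v y" using X D y pinv(2) by (simp flip: mult_assoc_vec_dim)
  ultimately have \<tau>_eq: "\<tau> = pinv (V * T) *\<^sub>v (V *\<^sub>v y)"
    unfolding \<tau>_def prls_tau_def DT Dy X_def[symmetric] by simp
  have \<tau>: "\<tau> \<in> carrier_vec m" unfolding \<tau>_eq carrier_vec_def using T by simp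
  have r: "r \<in> carrier_vec n" unfolding r_def using y T by (intro carrier_vecI) simp
  have H: "H_mat W T i \<in> carrier_mat n n"
    unfolding H_mat_def V_def[symmetric] using V T by auto
  have r_eq: "r = (1\<^sub>m n - H_mat W T i) *\<^sub>v y"
    using y T V H unfolding r_def \<tau>_eq
    by (simp add: minus_mult_vec_dim) (simp add: H_mat_def V_def[symmetric] mult_assoc_vec_dim)
  have "prls_lambda (delete_row i W) (delete_row i T) (delete_entry i y)
      = X *\<^sub>v (D *\<^sub>v y - D * T *\<^sub>v \<tau>)"
    unfolding X_def DT[symmetric] Dy[symmetric] \<tau>_def
    by (rule prls_lambda_full_row_rank[OF delete_row_carrier[OF W] delete_row_carrier[OF T]])
      (use y pinv(3) in \<open>auto simp: delete_entry_def X_def\<close>)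
  also have "D *\<^sub>v y - D * T *\<^sub>v \<tau> = D *\<^sub>v r"
    using D T y \<tau> unfolding r_def by (simp add: mult_minus_vec_dim mult_assoc_vec_dim)
  also have "X *\<^sub>v (D *\<^sub>v r) = V *\<^sub>v r"
    using X D r pinv(2) by (simp flip: mult_assoc_vec_dim)
  finally have lambda_eq: "prls_lambda (delete_row i W) (delete_row i T) (delete_entry i y) = V *\<^sub>v r" .
  have "row W i \<bullet> (V *\<^sub>v r) = (W * V *\<^sub>v r) $ i"
    using W V r i by (simp add: mult_assoc_vec_dim)
  also have "W * V *\<^sub>v r = r - (1 / g) \<cdot>\<^sub>v (coord_proj n i *\<^sub>v (G *\<^sub>v r))"
    unfolding V_def mult_W_tilde[OF W right_inv i] G_def[symmetric] g_def[symmetric]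
    using G r by (simp add: minus_mult_vec_dim smult_mult_vec_dim mult_assoc_vec_dim)
  also have "\<dots> $ i = r $ i - (G *\<^sub>v r) $ i / g"
    using G r i coord_proj_mult_vec_index[of "G *\<^sub>v r" n i] by simp
  finally have w: "row W i \<bullet> (V *\<^sub>v r) = r $ i - (G *\<^sub>v r) $ i / g" .
  \<comment> \<open>The contribution of \<open>T\<close> to the prediction is already contained in
    \<open>r\<close>.\<close>
  have "loo_residual W T y i = r $ i - row W i \<bullet> (V *\<^sub>v r)"
    using y T \<tau> i unfolding loo_residual_def lambda_eq \<tau>_def[symmetric] r_def by simp
  hence lhs: "loo_residual W T y i = (G *\<^sub>v r) $ i / g" by (simp add: w)

  define F :: "real mat" where "F = mat_diag n (\<lambda>j. 1 / G $$ (j, j))"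
  have F: "F \<in> carrier_mat n n" unfolding F_def by simp
  have "inv_mat (diag_part G) = F"
  proof (rule inv_mat_eqI)
    \<comment> \<open>Positivity of the diagonal of \<open>G\<close> makes every entry of
      \<open>F\<close> a true reciprocal.\<close>
    have "mat_diag n (\<lambda>j. G $$ (j, j) * (1 / G $$ (j, j))) = 1\<^sub>m n"
      "mat_diag n (\<lambda>j. 1 / G $$ (j, j) * G $$ (j, j)) = 1\<^sub>m n"
      using g by (auto simp: mat_diag_def intro!: eq_matI) force+
    thus "diag_part G * F = 1\<^sub>m n" "F * diag_part G = 1\<^sub>m n"
      using G unfolding diag_part_def F_def by simp_all
  qed (use G F in \<open>auto simp: diag_part_def\<close>)
  hence "unit_vec n i \<bullet> ((inv_mat (diag_part G) * G * (1\<^sub>m n - H_mat W T i)) *\<^sub>v y)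
      = (F *\<^sub>v (G *\<^sub>v r)) $ i"
    using F G H y i r mult_mat_vec_carrier[OF F mult_mat_vec_carrier[OF G r]] r_eq
    by (simp add: mult_assoc_vec_dim)
  also have "row F i = (1 / g) \<cdot>\<^sub>v unit_vec n i"
    using i by (intro eq_vecI) (auto simp: F_def mat_diag_def g_def)
  hence "(F *\<^sub>v (G *\<^sub>v r)) $ i = (G *\<^sub>v r) $ i / g"
    using F G r i by simp
  finally show ?thesis unfolding lhs G_def by simp
qed

end
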